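(* Let $(\mu_t,\mathfrak{T}_t)$, with $\mu_t=\sum_{i\ge0}\mu_it^i$ and $\mathfrak{T}_t=\sum_{i\ge0}\mathfrak{T}_it^i$, be a formal $1$-parameter deformation of a $\lambda$-weighted Rota-Baxter Lie algebra $(\mathfrak{g},\mathfrak{T})$. Then $(\mu_1,\mathfrak{T}_1)\in C^2_{\mathsf{RB}}(\mathfrak{g},\mathfrak{g})$ is a $2$-cocycle in the cohomology of $(\mathfrak{g},\mathfrak{T})$ with coefficients in the adjoint representation. Moreover, the corresponding cohomology class in $H^2_{\mathsf{RB}}(\mathfrak{g},\mathfrak{g})$ depends only on the equivalence class of the deformation $(\mu_t,\mathfrak{T}_t)$.
   Context: All vector spaces and (multi)linear maps are over a field $\mathbf{k}$ of characteristic $0$; $\lambda\in\mathbf{k}$ is a fixed scalar. A $\lambda$-weighted Rota-Baxter Lie algebra is a pair $(\mathfrak{g},\mathfrak{T})$ of a Lie algebra $\mathfrak{g}$ and a $\lambda$-weighted Rota-Baxter operator on it, i.e. a linear map $\mathfrak{T}:\mathfrak{g}\to\mathfrak{g}$ with $[\mathfrak{T}(x),\mathfrak{T}(y)]=\mathfrak{T}([\mathfrak{T}(x),y]+[x,\mathfrak{T}(y)]+\lambda[x,y])$ for all $x,y\in\mathfrak{g}$. A morphism $(\mathfrak{g},\mathfrak{T})\to(\mathfrak{g}',\mathfrak{T}')$ is a Lie algebra homomorphism $\phi$ with $\phi\circ\mathfrak{T}=\mathfrak{T}'\circ\phi$. The adjoint representation of $(\mathfrak{g},\mathfrak{T})$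 is $\mathfrak{g}$ with action $\rho(x)y=[x,y]$ together with the operator $\mathfrak{T}$. **Cohomology with coefficients in the adjoint representation.** Put $[x,y]_{\mathfrak{T}}=[\mathfrak{T}(x),y]+[x,\mathfrak{T}(y)]+\lambda[x,y]$ and $\widetilde{\rho}(x)y=[\mathfrak{T}(x),y]-\mathfrak{T}([x,y])$; then $(\mathfrak{g},[\,,]_{\mathfrak{T}})$ is a Lie algebra represented on $\mathfrak{g}$ by $\widetilde{\rho}$. For $f\in\mathrm{Hom}(\wedge^n\mathfrak{g},\mathfrak{g})$ let $$(\delta_{\mathsf{CE}}f)(x_1,\ldots,x_{n+1})=\sum_{i=1}^{n+1}(-1)^{i+n}\rho(x_i)f(x_1,\ldots,\widehat{x_i},\ldots,x_{n+1})+\sum_{1\le i<j\le n+1}(-1)^{i+j+n+1}f([x_i,x_j],x_1,\ldots,\widehat{x_i},\ldots,\widehat{x_j},\ldots,x_{n+1}),$$ and let $\partial_{\mathsf{CE}}$ be given by the same formula with $\rho$ replaced by $\widetilde{\rho}$ and $[\,,]$ replaced by $[\,,]_{\mathfrak{T}}$. Let $\Phi^0=\mathrm{id}_{\mathfrak{g}}$ and, for $n\ge1$, $$\Phi^n(f)(x_1,\ldots,x_n)=f(\mathfrak{T}(x_1),\ldots,\mathfrak{T}(x_n))-\sum_{k=0}^{n-1}\lambda^{n-k-1}\sum_{i_1<\cdots<i_k}\mathfrak{T}\big(f(x_1,\ldots,\mathfrak{T}(x_{i_1}),\ldots,\mathfrak{T}(x_{i_k}),\ldots,x_n)\big),$$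 where in the inner sum $\mathfrak{T}$ is applied exactly to the entries in positions $i_1,\ldots,i_k$. Set $C^0_{\mathsf{RB}}(\mathfrak{g},\mathfrak{g})=\mathfrak{g}$ and $C^n_{\mathsf{RB}}(\mathfrak{g},\mathfrak{g})=\mathrm{Hom}(\wedge^n\mathfrak{g},\mathfrak{g})\oplus\mathrm{Hom}(\wedge^{n-1}\mathfrak{g},\mathfrak{g})$ for $n\ge1$, with $\delta_{\mathsf{RB}}(v)=(\delta_{\mathsf{CE}}(v),-v)$ and $\delta_{\mathsf{RB}}(f,g)=(\delta_{\mathsf{CE}}(f),-\partial_{\mathsf{CE}}(g)-\Phi^n(f))$. This is a cochain complex, with cohomology $H^n_{\mathsf{RB}}(\mathfrak{g},\mathfrak{g})$. **Deformations.** Let $\mu\in\mathrm{Hom}(\wedge^2\mathfrak{g},\mathfrak{g})$ be the Lie bracket of $\mathfrak{g}$. A formal $1$-parameter deformation of $(\mathfrak{g},\mathfrak{T})$ is a pair of formal power series $\mu_t=\sum_{i\ge0}\mu_it^i$ with $\mu_i\in\mathrm{Hom}(\wedge^2\mathfrak{g},\mathfrak{g})$, $\mu_0=\mu$, and $\mathfrak{T}_t=\sum_{i\ge0}\mathfrak{T}_it^i$ with $\mathfrak{T}_i\in\mathrm{Hom}(\mathfrak{g},\mathfrak{g})$, $\mathfrak{T}_0=\mathfrak{T}$, such that the $\mathbf{k}[[t]]$-bilinear map $\mu_t$ is a Lie bracket on $\mathfrak{g}[[t]]$ and the $\mathbf{k}[[t]]$-linear map $\mathfrak{T}_t$ is a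 $\lambda$-weighted Rota-Baxter operator on $(\mathfrak{g}[[t]],\mu_t)$. Two deformations $(\mu_t,\mathfrak{T}_t)$ and $(\mu_t',\mathfrak{T}_t')$ are equivalent if there is $\phi_t=\sum_{i\ge0}\phi_it^i:\mathfrak{g}[[t]]\to\mathfrak{g}[[t]]$ with $\phi_i\in\mathrm{Hom}(\mathfrak{g},\mathfrak{g})$, $\phi_0=\mathrm{id}_{\mathfrak{g}}$, such that the $\mathbf{k}[[t]]$-linear map $\phi_t$ is a morphism of $\lambda$-weighted Rota-Baxter Lie algebras from $((\mathfrak{g}[[t]],\mu_t'),\mathfrak{T}_t')$ to $((\mathfrak{g}[[t]],\mu_t),\mathfrak{T}_t)$. *)

theory Defs
  imports
    "HOL-Library.Function_Algebras"
    "HOL-Library.Product_Plus"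
    "HOL-Computational_Algebra.Formal_Power_Series"
begin

section \<open>Rota-Baxter Lie algebras\<close>

text \<open>
  The base ring is an arbitrary commutative ring, because the notions are needed both over the
  field \<open>k\<close> and over \<open>k[[t]]\<close>. Over a field, the locale \<open>module\<close> has literally the axioms of
  \<open>vector_space\<close>.
\<close>

locale lie_algebra = module scale
  for scale :: "'r::comm_ring_1 \<Rightarrow> 'v::ab_group_add \<Rightarrow> 'v" +
  fixes bracket :: "'v \<Rightarrow> 'v \<Rightarrow> 'v"
  assumes bracket_hom_left: "module_hom scale scale (\<lambda>x. bracket x y)"
    and bracket_hom_right: "module_hom scale scale (bracket x)"
    and bracket_self: "bracket x x = 0"
    and jacobi: "bracket x (bracket y z) + bracket y (bracket z x) + bracket z (bracket x y) = 0"

locale rota_baxter_lie_algebra = lie_algebra scale bracket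
  for scale :: "'r::comm_ring_1 \<Rightarrow> 'v::ab_group_add \<Rightarrow> 'v"
    and bracket :: "'v \<Rightarrow> 'v \<Rightarrow> 'v" +
  fixes lam :: 'r and T :: "'v \<Rightarrow> 'v"
  assumes operator_hom: "module_hom scale scale T"
    and rota_baxter:
      "bracket (T x) (T y) = T (bracket (T x) y + bracket x (T y) + scale lam (bracket x y))"

definition rota_baxter_morphism ::
  "('r::comm_ring_1 \<Rightarrow> 'v::ab_group_add \<Rightarrow> 'v) \<Rightarrow> 'r \<Rightarrow>
    ('v \<Rightarrow> 'v \<Rightarrow> 'v) \<Rightarrow> ('v \<Rightarrow> 'v) \<Rightarrow> ('v \<Rightarrow> 'v \<Rightarrow> 'v) \<Rightarrow> ('v \<Rightarrow> 'v) \<Rightarrow> ('v \<Rightarrow> 'v) \<Rightarrow> bool"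
  where "rota_baxter_morphism scale lam bracket T bracket' T' \<phi> \<longleftrightarrow>
    rota_baxter_lie_algebra scale bracket lam T \<and>
    rota_baxter_lie_algebra scale bracket' lam T' \<and>
    module_hom scale scale \<phi> \<and>
    (\<forall>x y. \<phi> (bracket x y) = bracket' (\<phi> x) (\<phi> y)) \<and>
    \<phi> \<circ> T = T' \<circ> \<phi>"

section \<open>Cochains and differentials\<close>

text \<open>
  The arguments of an \<open>n\<close>-ary map are given as a list. An element of \<open>Hom(\<and>\<^sup>n V, V)\<close> is an
  alternating multilinear map on lists of length \<open>n\<close>, extended by \<open>0\<close> to lists of any other length,
  so that equality of cochains is equality of functions.
\<close>

definition alt_hom :: "('r::comm_ring_1 \<Rightarrow> 'v::ab_group_add \<Rightarrow> 'v) \<Rightarrow> nat \<Rightarrow> ('v list \<Rightarrow> 'v) set"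
  where "alt_hom scale n = {f.
    (\<forall>xs. length xs \<noteq> n \<longrightarrow> f xs = 0) \<and>
    (\<forall>xs i. length xs = n \<longrightarrow> i < n \<longrightarrow> module_hom scale scale (\<lambda>x. f (xs[i := x]))) \<and>
    (\<forall>xs i j. length xs = n \<longrightarrow> i < j \<longrightarrow> j < n \<longrightarrow> xs ! i = xs ! j \<longrightarrow> f xs = 0)}"

text \<open>
  Chevalley-Eilenberg differential of an \<open>n\<close>-cochain for a bracket \<open>br\<close> and an action \<open>\<rho>\<close>.
  Positions are counted from \<open>0\<close>; hence the sign exponents \<open>(i + 1) + n\<close> and
  \<open>(i + 1) + (j + 1) + n + 1\<close>. The list \<open>nths xs (- I)\<close> is \<open>xs\<close> with the positions in \<open>I\<close> omitted.
\<close>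

definition ce_differential ::
  "('r::comm_ring_1 \<Rightarrow> 'v::ab_group_add \<Rightarrow> 'v) \<Rightarrow> ('v \<Rightarrow> 'v \<Rightarrow> 'v) \<Rightarrow> ('v \<Rightarrow> 'v \<Rightarrow> 'v) \<Rightarrow>
    nat \<Rightarrow> ('v list \<Rightarrow> 'v) \<Rightarrow> ('v list \<Rightarrow> 'v)"
  where "ce_differential scale br \<rho> n f = (\<lambda>xs. if length xs = Suc n then
      (\<Sum>i<Suc n. scale ((-1) ^ ((i + 1) + n)) (\<rho> (xs ! i) (f (nths xs (- {i}))))) +
      (\<Sum>j<Suc n. \<Sum>i<j. scale ((-1) ^ ((i + 1) + (j + 1) + n + 1))
         (f (br (xs ! i) (xs ! j) # nths xs (- {i, j}))))
    else 0)"

definition induced_bracket ::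
  "('r::comm_ring_1 \<Rightarrow> 'v::ab_group_add \<Rightarrow> 'v) \<Rightarrow> ('v \<Rightarrow> 'v \<Rightarrow> 'v) \<Rightarrow> 'r \<Rightarrow> ('v \<Rightarrow> 'v) \<Rightarrow>
    'v \<Rightarrow> 'v \<Rightarrow> 'v"
  where "induced_bracket scale bracket lam T x y =
    bracket (T x) y + bracket x (T y) + scale lam (bracket x y)"

definition induced_action ::
  "('v::ab_group_add \<Rightarrow> 'v \<Rightarrow> 'v) \<Rightarrow> ('v \<Rightarrow> 'v) \<Rightarrow> 'v \<Rightarrow> 'v \<Rightarrow> 'v"
  where "induced_action bracket T x y = bracket (T x) y - T (bracket x y)"

text \<open>
  The subset \<open>I\<close> is the set of positions to which \<open>T\<close> is applied. For \<open>n = 0\<close> the sum over \<open>k\<close> is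
  empty and the map is the identity on \<open>0\<close>-cochains.
\<close>

definition rb_Phi ::
  "('r::comm_ring_1 \<Rightarrow> 'v::ab_group_add \<Rightarrow> 'v) \<Rightarrow> 'r \<Rightarrow> ('v \<Rightarrow> 'v) \<Rightarrow>
    nat \<Rightarrow> ('v list \<Rightarrow> 'v) \<Rightarrow> ('v list \<Rightarrow> 'v)"
  where "rb_Phi scale lam T n f = (\<lambda>xs. if length xs = n then
      f (map T xs) -
      (\<Sum>k<n. scale (lam ^ (n - k - 1)) (\<Sum>I | I \<subseteq> {..<n} \<and> card I = k.
         T (f (map (\<lambda>i. if i \<in> I then T (xs ! i) else xs ! i) [0..<n]))))
    else 0)"

text \<open>
  In degree \<open>0\<close> the second summand is absent, which is encoded by a zero second component; the
  vector \<open>v\<close> corresponds to the \<open>0\<close>-ary map \<open>f\<close> with \<open>f [] = v\<close>.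
\<close>

definition rb_cochains ::
  "('r::comm_ring_1 \<Rightarrow> 'v::ab_group_add \<Rightarrow> 'v) \<Rightarrow> nat \<Rightarrow> (('v list \<Rightarrow> 'v) \<times> ('v list \<Rightarrow> 'v)) set"
  where "rb_cochains scale n =
    (if n = 0 then alt_hom scale 0 \<times> {0} else alt_hom scale n \<times> alt_hom scale (n - 1))"

definition rb_differential ::
  "('r::comm_ring_1 \<Rightarrow> 'v::ab_group_add \<Rightarrow> 'v) \<Rightarrow> ('v \<Rightarrow> 'v \<Rightarrow> 'v) \<Rightarrow> 'r \<Rightarrow> ('v \<Rightarrow> 'v) \<Rightarrow>
    nat \<Rightarrow> ('v list \<Rightarrow> 'v) \<times> ('v list \<Rightarrow> 'v) \<Rightarrow> ('v list \<Rightarrow> 'v) \<times> ('v list \<Rightarrow> 'v)"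
  where "rb_differential scale bracket lam T n = (\<lambda>(f, g).
    if n = 0 then (ce_differential scale bracket bracket 0 f, - f)
    else (ce_differential scale bracket bracket n f,
      - ce_differential scale (induced_bracket scale bracket lam T) (induced_action bracket T) (n - 1) g
      - rb_Phi scale lam T n f))"

definition rb_cocycles ::
  "('r::comm_ring_1 \<Rightarrow> 'v::ab_group_add \<Rightarrow> 'v) \<Rightarrow> ('v \<Rightarrow> 'v \<Rightarrow> 'v) \<Rightarrow> 'r \<Rightarrow> ('v \<Rightarrow> 'v) \<Rightarrow>
    nat \<Rightarrow> (('v list \<Rightarrow> 'v) \<times> ('v list \<Rightarrow> 'v)) set"
  where "rb_cocycles scale bracket lam T n =
    {c \<in> rb_cochains scale n. rb_differential scale bracket lam T n c = 0}"

definition rb_coboundaries ::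
  "('r::comm_ring_1 \<Rightarrow> 'v::ab_group_add \<Rightarrow> 'v) \<Rightarrow> ('v \<Rightarrow> 'v \<Rightarrow> 'v) \<Rightarrow> 'r \<Rightarrow> ('v \<Rightarrow> 'v) \<Rightarrow>
    nat \<Rightarrow> (('v list \<Rightarrow> 'v) \<times> ('v list \<Rightarrow> 'v)) set"
  where "rb_coboundaries scale bracket lam T n =
    (if n = 0 then {0} else rb_differential scale bracket lam T (n - 1) ` rb_cochains scale (n - 1))"

definition rb_cohomologous ::
  "('r::comm_ring_1 \<Rightarrow> 'v::ab_group_add \<Rightarrow> 'v) \<Rightarrow> ('v \<Rightarrow> 'v \<Rightarrow> 'v) \<Rightarrow> 'r \<Rightarrow> ('v \<Rightarrow> 'v) \<Rightarrow>
    nat \<Rightarrow> (('v list \<Rightarrow> 'v) \<times> ('v list \<Rightarrow> 'v)) rel"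
  where "rb_cohomologous scale bracket lam T n =
    {(c, c'). c \<in> rb_cocycles scale bracket lam T n \<and> c' \<in> rb_cocycles scale bracket lam T n \<and>
      c - c' \<in> rb_coboundaries scale bracket lam T n}"

definition rb_cohomology ::
  "('r::comm_ring_1 \<Rightarrow> 'v::ab_group_add \<Rightarrow> 'v) \<Rightarrow> ('v \<Rightarrow> 'v \<Rightarrow> 'v) \<Rightarrow> 'r \<Rightarrow> ('v \<Rightarrow> 'v) \<Rightarrow>
    nat \<Rightarrow> (('v list \<Rightarrow> 'v) \<times> ('v list \<Rightarrow> 'v)) set set"
  where "rb_cohomology scale bracket lam T n =
    rb_cocycles scale bracket lam T n // rb_cohomologous scale bracket lam T n"

definition rb_class ::
  "('r::comm_ring_1 \<Rightarrow> 'v::ab_group_add \<Rightarrow> 'v) \<Rightarrow> ('v \<Rightarrow> 'v \<Rightarrow> 'v) \<Rightarrow> 'r \<Rightarrow> ('v \<Rightarrow> 'v) \<Rightarrow>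
    nat \<Rightarrow> ('v list \<Rightarrow> 'v) \<times> ('v list \<Rightarrow> 'v) \<Rightarrow> (('v list \<Rightarrow> 'v) \<times> ('v list \<Rightarrow> 'v)) set"
  where "rb_class scale bracket lam T n c = rb_cohomologous scale bracket lam T n `` {c}"

section \<open>Formal deformations\<close>

text \<open>
  The space \<open>V[[t]]\<close> is the type \<open>'v fps\<close>; its \<open>k[[t]]\<close>-module structure is the Cauchy product.
\<close>

definition fps_scale ::
  "('k::comm_ring_1 \<Rightarrow> 'v::ab_group_add \<Rightarrow> 'v) \<Rightarrow> 'k fps \<Rightarrow> 'v fps \<Rightarrow> 'v fps"
  where "fps_scale scale a x =
    Abs_fps (\<lambda>n. \<Sum>i\<le>n. scale (fps_nth a i) (fps_nth x (n - i)))"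

text \<open>
  The \<open>k[[t]]\<close>-(bi)linear maps on \<open>V[[t]]\<close> given by power series of (bi)linear maps on \<open>V\<close>.
\<close>

definition fps_linear_ext :: "('v::ab_group_add list \<Rightarrow> 'v) fps \<Rightarrow> 'v fps \<Rightarrow> 'v fps"
  where "fps_linear_ext F x =
    Abs_fps (\<lambda>n. \<Sum>i\<le>n. fps_nth F i [fps_nth x (n - i)])"

definition fps_bilinear_ext :: "('v::ab_group_add list \<Rightarrow> 'v) fps \<Rightarrow> 'v fps \<Rightarrow> 'v fps \<Rightarrow> 'v fps"
  where "fps_bilinear_ext M x y =
    Abs_fps (\<lambda>n. \<Sum>i\<le>n. \<Sum>j\<le>n - i. fps_nth M i [fps_nth x j, fps_nth y (n - i - j)])"

definition rb_deformation ::
  "('k::comm_ring_1 \<Rightarrow> 'v::ab_group_add \<Rightarrow> 'v) \<Rightarrow> ('v \<Rightarrow> 'v \<Rightarrow> 'v) \<Rightarrow> 'k \<Rightarrow> ('v \<Rightarrow> 'v) \<Rightarrow>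
    ('v list \<Rightarrow> 'v) fps \<Rightarrow> ('v list \<Rightarrow> 'v) fps \<Rightarrow> bool"
  where "rb_deformation scale bracket lam T M N \<longleftrightarrow>
    (\<forall>i. fps_nth M i \<in> alt_hom scale 2) \<and> (\<forall>x y. fps_nth M 0 [x, y] = bracket x y) \<and>
    (\<forall>i. fps_nth N i \<in> alt_hom scale 1) \<and> (\<forall>x. fps_nth N 0 [x] = T x) \<and>
    rota_baxter_lie_algebra (fps_scale scale) (fps_bilinear_ext M) (fps_const lam) (fps_linear_ext N)"

definition rb_equivalent ::
  "('k::comm_ring_1 \<Rightarrow> 'v::ab_group_add \<Rightarrow> 'v) \<Rightarrow> 'k \<Rightarrow>
    ('v list \<Rightarrow> 'v) fps \<Rightarrow> ('v list \<Rightarrow> 'v) fps \<Rightarrow> ('v list \<Rightarrow> 'v) fps \<Rightarrow> ('v list \<Rightarrow> 'v) fps \<Rightarrow> bool"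
  where "rb_equivalent scale lam M N M' N' \<longleftrightarrow> (\<exists>P :: ('v list \<Rightarrow> 'v) fps.
    (\<forall>i. fps_nth P i \<in> alt_hom scale 1) \<and> (\<forall>x. fps_nth P 0 [x] = x) \<and>
    rota_baxter_morphism (fps_scale scale) (fps_const lam)
      (fps_bilinear_ext M') (fps_linear_ext N') (fps_bilinear_ext M) (fps_linear_ext N)
      (fps_linear_ext P))"

end

theory Submission
  imports Defs
begin

text \<open>
  The first-order term of a deformation satisfies the derivatives at \<open>t = 0\<close> of the equations that the
  deformation satisfies. Evaluating an identity between maps on \<open>V[[t]]\<close> at constant series and comparing
  the coefficients of \<open>t\<close> therefore turns:

  \<^item> the Jacobi identity of \<open>\<mu>\<^sub>t\<close> into \<open>\<delta>\<^sub>C\<^sub>E \<mu>\<^sub>1 = 0\<close>;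
  \<^item> the Rota-Baxter identity of \<open>(\<mu>\<^sub>t, T\<^sub>t)\<close> into \<open>\<partial>\<^sub>C\<^sub>E T\<^sub>1 + \<Phi>\<^sup>2 \<mu>\<^sub>1 = 0\<close>;
  \<^item> compatibility of \<open>\<phi>\<^sub>t\<close> with the brackets into \<open>\<mu>\<^sub>1' - \<mu>\<^sub>1 = \<delta>\<^sub>C\<^sub>E \<phi>\<^sub>1\<close>;
  \<^item> compatibility of \<open>\<phi>\<^sub>t\<close> with the operators into \<open>T\<^sub>1' - T\<^sub>1 = T \<phi>\<^sub>1 - \<phi>\<^sub>1 T = - \<Phi>\<^sup>1 \<phi>\<^sub>1\<close>.

  The first two say that \<open>(\<mu>\<^sub>1, T\<^sub>1)\<close> is a 2-cocycle (\<open>rb_cocycle_2I\<close>,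
  \<open>rb_deformation_infinitesimal_cocycle\<close>); the last two say that equivalent deformations have
  infinitesimals that differ by the coboundary of \<open>(\<phi>\<^sub>1, 0)\<close>
  (\<open>rb_equivalent_infinitesimals_cohomologous\<close>). Their classes agree because coboundaries form an
  additive group (\<open>rb_class_eqI\<close>).
\<close>

section \<open>Alternating maps of low arity\<close>

lemma alt_hom_diff:
  fixes scale :: "'r::comm_ring_1 \<Rightarrow> 'v::ab_group_add \<Rightarrow> 'v"
  assumes "module scale" "f \<in> alt_hom scale n" "g \<in> alt_hom scale n"
  shows "f - g \<in> alt_hom scale n"
proof -
  interpret module_pair scale scale using assms(1) by (simp add: module_pair_def)
  show ?thesis
    using assms(2,3) by (auto simp: alt_hom_def intro!: module_hom_sub)
qed

lemma alt_hom_zero: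
  fixes scale :: "'r::comm_ring_1 \<Rightarrow> 'v::ab_group_add \<Rightarrow> 'v"
  assumes "module scale"
  shows "0 \<in> alt_hom scale n"
proof -
  interpret module_pair scale scale using assms(1) by (simp add: module_pair_def)
  show ?thesis
    by (auto simp: alt_hom_def module_hom_zero)
qed

lemma alt_hom_2D:
  assumes "f \<in> alt_hom scale 2"
  shows "module_hom scale scale (\<lambda>x. f [x, y])" "module_hom scale scale (\<lambda>x. f [y, x])"
    "f [x, x] = 0"
proof -
  have *: "length xs = 2 \<Longrightarrow> i < 2 \<Longrightarrow> module_hom scale scale (\<lambda>x. f (xs[i := x]))" for xs i
    using assms by (auto simp: alt_hom_def)
  show "module_hom scale scale (\<lambda>x. f [x, y])" using *[of "[y, y]" 0] by simp
  show "module_hom scale scale (\<lambda>x. f [y, x])" using *[of "[y, y]" 1] by simp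
  have "length xs = 2 \<Longrightarrow> i < j \<Longrightarrow> j < 2 \<Longrightarrow> xs ! i = xs ! j \<Longrightarrow> f xs = 0" for xs i j
    using assms by (auto simp: alt_hom_def)
  from this[of "[x, x]" 0 1] show "f [x, x] = 0" by simp
qed

lemma alt_hom_2_swap:
  assumes "f \<in> alt_hom scale 2"
  shows "f [y, x] = - f [x, y]"
proof -
  note add = module_hom.add[OF alt_hom_2D(1)[OF assms]] module_hom.add[OF alt_hom_2D(2)[OF assms]]
  have "f [x + y, x + y] = f [x, x] + f [x, y] + (f [y, x] + f [y, y])"
    by (simp only: add ac_simps)
  then have "f [x, y] + f [y, x] = 0" by (simp add: alt_hom_2D(3)[OF assms])
  then show ?thesis by (simp add: eq_neg_iff_add_eq_0 add.commute)
qed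

lemma length_2_iff: "length xs = 2 \<longleftrightarrow> (\<exists>x y. xs = [x, y])"
  by (auto simp: numeral_2_eq_2 length_Suc_conv)

lemma length_3_iff: "length xs = 3 \<longleftrightarrow> (\<exists>x y z. xs = [x, y, z])"
  by (auto simp: numeral_3_eq_3 length_Suc_conv)

section \<open>First-order coefficients of maps on power series\<close>

lemma fps_linear_ext_nth_0: "fps_nth (fps_linear_ext F x) 0 = fps_nth F 0 [fps_nth x 0]"
  by (simp add: fps_linear_ext_def)

lemma fps_linear_ext_nth_1:
  "fps_nth (fps_linear_ext F x) (Suc 0) = fps_nth F 0 [fps_nth x 1] + fps_nth F 1 [fps_nth x 0]"
  by (simp add: fps_linear_ext_def)

lemma fps_bilinear_ext_nth_0:
  "fps_nth (fps_bilinear_ext M x y) 0 = fps_nth M 0 [fps_nth x 0, fps_nth y 0]"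
  by (simp add: fps_bilinear_ext_def)

lemma fps_bilinear_ext_nth_1:
  "fps_nth (fps_bilinear_ext M x y) (Suc 0) =
    fps_nth M 0 [fps_nth x 0, fps_nth y 1] + fps_nth M 0 [fps_nth x 1, fps_nth y 0] +
    fps_nth M 1 [fps_nth x 0, fps_nth y 0]"
  by (simp add: fps_bilinear_ext_def)

lemma (in module) fps_scale_const_nth:
  "fps_nth (fps_scale scale (fps_const a) x) n = scale a (fps_nth x n)"
  by (simp add: fps_scale_def if_distrib[of "\<lambda>c. scale c _"] cong: if_cong)

lemmas first_order_coefficients =
  fps_linear_ext_nth_0 fps_linear_ext_nth_1 fps_bilinear_ext_nth_0 fps_bilinear_ext_nth_1

section \<open>Coboundaries and cohomology classes\<close>

context rota_baxter_lie_algebra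
begin

lemma bracket_simps:
  "bracket (x + y) z = bracket x z + bracket y z" "bracket z (x + y) = bracket z x + bracket z y"
  "bracket (x - y) z = bracket x z - bracket y z" "bracket z (x - y) = bracket z x - bracket z y"
  "bracket (- x) z = - bracket x z" "bracket z (- x) = - bracket z x"
  "bracket 0 z = 0" "bracket z 0 = 0"
  using module_hom.add[OF bracket_hom_left] module_hom.add[OF bracket_hom_right]
    module_hom.diff[OF bracket_hom_left] module_hom.diff[OF bracket_hom_right]
    module_hom.neg[OF bracket_hom_left] module_hom.neg[OF bracket_hom_right]
    module_hom.zero[OF bracket_hom_left] module_hom.zero[OF bracket_hom_right]
  by simp_all

lemma bracket_swap: "bracket y x = - bracket x y"
proof -
  have "bracket (x + y) (x + y) = 0" by (rule bracket_self)
  \<comment> \<open>The instances of \<open>bracket_self\<close> keep the simplifier from rewriting the fact above to \<open>True\<close>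
    before it is expanded.\<close>
  then have "bracket x y + bracket y x = 0"
    by (simp add: bracket_simps(1,2) bracket_self[of x] bracket_self[of y] add.commute)
  then show ?thesis by (simp add: eq_neg_iff_add_eq_0 add.commute)
qed

lemmas T_simps = module_hom.add[OF operator_hom] module_hom.diff[OF operator_hom]
  module_hom.neg[OF operator_hom] module_hom.zero[OF operator_hom]
  module_hom.scale[OF operator_hom]

lemma ce_differential_diff:
  assumes "\<And>x y z. \<rho> x (y - z) = \<rho> x y - \<rho> x z"
  shows "ce_differential scale br \<rho> n (f - g) =
    ce_differential scale br \<rho> n f - ce_differential scale br \<rho> n g"
  by (rule ext) (simp add: ce_differential_def assms scale_right_diff_distrib sum_subtractf
      del: sum.lessThan_Suc power_Suc minus_add_distrib)

lemma rb_Phi_diff: "rb_Phi scale lam T n (f - g) = rb_Phi scale lam T n f - rb_Phi scale lam T n g"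
  by (rule ext) (simp add: rb_Phi_def T_simps scale_right_diff_distrib sum_subtractf)

lemma induced_action_diff:
  "induced_action bracket T x (y - z) = induced_action bracket T x y - induced_action bracket T x z"
  by (simp add: induced_action_def bracket_simps T_simps)

lemma rb_differential_diff:
  "rb_differential scale bracket lam T n (c - d) =
    rb_differential scale bracket lam T n c - rb_differential scale bracket lam T n d"
  by (cases c; cases d)
    (simp add: rb_differential_def ce_differential_diff bracket_simps rb_Phi_diff
      induced_action_diff)

lemma rb_cochains_diff:
  "c \<in> rb_cochains scale n \<Longrightarrow> d \<in> rb_cochains scale n \<Longrightarrow> c - d \<in> rb_cochains scale n"
  using module_axioms by (auto simp: rb_cochains_def alt_hom_diff split: if_splits)

lemma rb_coboundaries_diff:
  assumes "c \<in> rb_coboundaries scale bracket lam T n" "d \<in> rb_coboundaries scale bracket lam T n"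
  shows "c - d \<in> rb_coboundaries scale bracket lam T n"
proof (cases "n = 0")
  case True
  then show ?thesis using assms by (simp add: rb_coboundaries_def)
next
  case False
  then show ?thesis using assms
    by (auto simp: rb_coboundaries_def rb_differential_diff[symmetric] simp del: diff_Pair
      intro!: imageI rb_cochains_diff)
qed

text \<open>
  The classes of \<open>c\<close> and \<open>c'\<close> consist of the cocycles \<open>d\<close> for which \<open>c - d\<close>, respectively \<open>c' - d\<close>, is a
  coboundary. These conditions on \<open>d\<close> are equivalent because the two differences themselves differ by a
  coboundary and coboundaries form a subgroup.
\<close>

lemma rb_class_eqI:
  assumes "c - c' \<in> rb_coboundaries scale bracket lam T n"
    and "c \<in> rb_cocycles scale bracket lam T n" "c' \<in> rb_cocycles scale bracket lam T n"
  shows "rb_class scale bracket lam T n c = rb_class scale bracket lam T n c'"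
proof -
  let ?B = "rb_coboundaries scale bracket lam T n"
  have "0 \<in> ?B" using rb_coboundaries_diff[OF assms(1) assms(1)] by simp
  then have neg: "c' - c \<in> ?B" using rb_coboundaries_diff[OF _ assms(1), of 0] by simp
  have "c - d \<in> ?B \<longleftrightarrow> c' - d \<in> ?B" for d
    using rb_coboundaries_diff[of "c - d" n "c - c'"] rb_coboundaries_diff[of "c' - d" n "c' - c"]
      assms(1) neg by auto
  then show ?thesis using assms(2,3) by (auto simp: rb_class_def rb_cohomologous_def)
qed

end

section \<open>The differential in low degrees\<close>

lemma subsets_card_0: "{I. I \<subseteq> {..<n::nat} \<and> card I = 0} = {{}}"
  by (auto dest: finite_subset)

lemma subsets_2_card_1: "{I. I \<subseteq> {..<2::nat} \<and> card I = Suc 0} = {{0}, {1}}"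
  by (auto simp: card_Suc_eq)

context rota_baxter_lie_algebra
begin

text \<open>
  Antisymmetry of \<open>bracket\<close> and of \<open>f\<close> reorders the six terms so that the right-hand side is the
  derivative of the cyclic Jacobi sum at \<open>bracket\<close> in the direction \<open>f\<close>.
\<close>

lemma ce_differential_2:
  assumes "f \<in> alt_hom scale 2"
  shows "ce_differential scale bracket bracket 2 f [x, y, z] =
    - (bracket x (f [y, z]) + f [x, bracket y z] + bracket y (f [z, x]) + f [y, bracket z x] +
       bracket z (f [x, y]) + f [z, bracket x y])"
proof -
  have "f [bracket x z, y] = f [y, bracket z x]"
    using bracket_swap[of z x] module_hom.neg[OF alt_hom_2D(2)[OF assms]] alt_hom_2_swap[OF assms]
    by metis
  moreover have "bracket y (f [x, z]) = - bracket y (f [z, x])"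
    using alt_hom_2_swap[OF assms, of x z] by (simp add: bracket_simps)
  moreover have "f [bracket x y, z] = - f [z, bracket x y]" "f [bracket y z, x] = - f [x, bracket y z]"
    by (rule alt_hom_2_swap[OF assms])+
  ultimately show ?thesis
    by (simp add: ce_differential_def nths_Cons numeral_2_eq_2 numeral_3_eq_3)
qed

lemma ce_differential_1:
  "ce_differential scale br \<rho> 1 f [x, y] = \<rho> x (f [y]) - \<rho> y (f [x]) - f [br x y]"
  by (simp add: ce_differential_def nths_Cons numeral_2_eq_2)

lemma rb_Phi_1: "rb_Phi scale lam T 1 f [x] = f [T x] - T (f [x])"
  unfolding rb_Phi_def by (simp add: subsets_card_0)

lemma rb_Phi_2:
  "rb_Phi scale lam T 2 f [x, y] =
    f [T x, T y] - T (f [T x, y]) - T (f [x, T y]) - scale lam (T (f [x, y]))"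
proof -
  have idx: "[0..<2::nat] = [0, 1]" and below: "{..<2::nat} = {0, 1}"
    by (auto simp: upt_rec)
  have "(\<Sum>k\<in>{0, 1}. scale (lam ^ (2 - k - 1)) (\<Sum>I | I \<subseteq> {..<2} \<and> card I = k.
         T (f (map (\<lambda>i. if i \<in> I then T ([x,y] ! i) else [x,y] ! i) [0..<2])))) =
     scale lam (T (f [x, y])) + (T (f [T x, y]) + T (f [x, T y]))"
    by (simp add: subsets_card_0 subsets_2_card_1 idx)
  then show ?thesis
    unfolding rb_Phi_def below[symmetric] by simp
qed

section \<open>Infinitesimals of deformations\<close>

text \<open>
  The two hypotheses are the equations for \<open>(bracket + t f, T + t g)\<close> to be a Rota-Baxter Lie algebra modulo
  \<open>t\<^sup>2\<close>. The second matches the second component of the differential because \<open>induced_action\<close> collects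
  the terms in which \<open>g\<close> is bracketed, \<open>induced_bracket\<close> those in which \<open>g\<close> is outermost, and
  \<open>rb_Phi\<close> those that contain \<open>f\<close>.
\<close>

lemma rb_cocycle_2I:
  assumes f: "f \<in> alt_hom scale 2" and g: "g \<in> alt_hom scale 1"
    and linearised_jacobi: "\<And>x y z.
      bracket x (f [y, z]) + f [x, bracket y z] + bracket y (f [z, x]) + f [y, bracket z x] +
      bracket z (f [x, y]) + f [z, bracket x y] = 0"
    and linearised_rota_baxter: "\<And>x y.
      f [T x, T y] + bracket (g [x]) (T y) + bracket (T x) (g [y]) =
      g [induced_bracket scale bracket lam T x y] +
      T (f [T x, y] + bracket (g [x]) y + f [x, T y] + bracket x (g [y]) + scale lam (f [x, y]))"
  shows "(f, g) \<in> rb_cocycles scale bracket lam T 2"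
proof -
  have "ce_differential scale bracket bracket 2 f xs = 0" for xs
  proof (cases "length xs = 3")
    case True
    then obtain x y z where xs: "xs = [x, y, z]" by (auto simp: length_3_iff)
    show ?thesis
      unfolding xs ce_differential_2[OF f] linearised_jacobi by simp
  qed (simp add: ce_differential_def)
  moreover have "ce_differential scale (induced_bracket scale bracket lam T)
      (induced_action bracket T) 1 g xs + rb_Phi scale lam T 2 f xs = 0" for xs
  proof (cases "length xs = 2")
    case True
    then obtain x y where xs: "xs = [x, y]" by (auto simp: length_2_iff)
    show ?thesis
      using linearised_rota_baxter[of x y] bracket_swap[of "T y" "g [x]"] bracket_swap[of y "g [x]"]
      unfolding xs ce_differential_1 rb_Phi_2
      by (simp add: induced_action_def T_simps algebra_simps)
  qed (simp add: ce_differential_def rb_Phi_def)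
  ultimately have "ce_differential scale bracket bracket 2 f = 0"
    and "ce_differential scale (induced_bracket scale bracket lam T) (induced_action bracket T) 1 g
      + rb_Phi scale lam T 2 f = 0"
    by (auto intro!: ext)
  then show ?thesis
    using f g by (simp add: rb_cocycles_def rb_cochains_def rb_differential_def zero_prod_def
        diff_eq_eq eq_neg_iff_add_eq_0 neg_eq_iff_add_eq_0)
qed

lemma rb_deformation_infinitesimal_cocycle:
  assumes "rb_deformation scale bracket lam T M N"
  shows "(fps_nth M 1, fps_nth N 1) \<in> rb_cocycles scale bracket lam T 2"
proof (rule rb_cocycle_2I)
  interpret deformed: rota_baxter_lie_algebra "fps_scale scale" "fps_bilinear_ext M" "fps_const lam"
    "fps_linear_ext N"
    using assms by (simp add: rb_deformation_def)
  have M0: "fps_nth M 0 [x, y] = bracket x y" and N0: "fps_nth N 0 [x] = T x"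
    and M: "fps_nth M i \<in> alt_hom scale 2" and N: "fps_nth N i \<in> alt_hom scale 1" for x y i
    using assms by (auto simp: rb_deformation_def)
  show "fps_nth M 1 \<in> alt_hom scale 2" "fps_nth N 1 \<in> alt_hom scale 1" by (rule M N)+
  \<comment> \<open>The arguments are constant series, so every term that contains one of their coefficients of \<open>t\<close>
    is killed by \<open>bracket\<close> or \<open>T\<close> being zero at \<open>0\<close>.\<close>
  note coefficients = first_order_coefficients M0 N0 bracket_simps(7,8) T_simps(4) fps_scale_const_nth
  show "bracket x (fps_nth M 1 [y, z]) + fps_nth M 1 [x, bracket y z] +
      bracket y (fps_nth M 1 [z, x]) + fps_nth M 1 [y, bracket z x] +
      bracket z (fps_nth M 1 [x, y]) + fps_nth M 1 [z, bracket x y] = 0" for x y z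
    using arg_cong[OF deformed.jacobi[of "fps_const x" "fps_const y" "fps_const z"],
        of "\<lambda>s. fps_nth s (Suc 0)"]
    by (simp add: coefficients add.assoc)
  show "fps_nth M 1 [T x, T y] + bracket (fps_nth N 1 [x]) (T y) + bracket (T x) (fps_nth N 1 [y]) =
      fps_nth N 1 [induced_bracket scale bracket lam T x y] +
      T (fps_nth M 1 [T x, y] + bracket (fps_nth N 1 [x]) y + fps_nth M 1 [x, T y] +
        bracket x (fps_nth N 1 [y]) + scale lam (fps_nth M 1 [x, y]))" for x y
    using arg_cong[OF deformed.rota_baxter[of "fps_const x" "fps_const y"],
        of "\<lambda>s. fps_nth s (Suc 0)"]
    by (simp add: coefficients induced_bracket_def ac_simps)
qed

text \<open>
  The first-order term \<open>\<phi>\<^sub>1\<close> of the equivalence is the primitive. An equivalence runs from the primed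
  deformation to the unprimed one, which gives the difference this sign.
\<close>

lemma rb_equivalent_infinitesimals_cohomologous:
  assumes "rb_deformation scale bracket lam T M N" "rb_deformation scale bracket lam T M' N'"
    and "rb_equivalent scale lam M N M' N'"
  shows "(fps_nth M' 1, fps_nth N' 1) - (fps_nth M 1, fps_nth N 1) \<in>
    rb_coboundaries scale bracket lam T 2"
proof -
  obtain P where P: "\<And>i. fps_nth P i \<in> alt_hom scale 1" and P0: "\<And>x. fps_nth P 0 [x] = x"
    and morphism: "rota_baxter_morphism (fps_scale scale) (fps_const lam)
      (fps_bilinear_ext M') (fps_linear_ext N') (fps_bilinear_ext M) (fps_linear_ext N)
      (fps_linear_ext P)"
    using assms(3) by (auto simp: rb_equivalent_def)
  have M0: "fps_nth M 0 [x, y] = bracket x y" "fps_nth M' 0 [x, y] = bracket x y"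
    and N0: "fps_nth N 0 [x] = T x" "fps_nth N' 0 [x] = T x"
    and length_M: "length xs \<noteq> 2 \<Longrightarrow> fps_nth M 1 xs = 0" "length xs \<noteq> 2 \<Longrightarrow> fps_nth M' 1 xs = 0"
    and length_N: "length xs \<noteq> 1 \<Longrightarrow> fps_nth N 1 xs = 0" "length xs \<noteq> 1 \<Longrightarrow> fps_nth N' 1 xs = 0"
    for x y xs
    using assms(1,2) by (simp_all add: rb_deformation_def alt_hom_def)
  note coefficients = first_order_coefficients M0 N0 P0 bracket_simps(7,8) T_simps(4)
  have bracket_1: "fps_nth M' 1 [x, y] - fps_nth M 1 [x, y] =
      bracket x (fps_nth P 1 [y]) - bracket y (fps_nth P 1 [x]) - fps_nth P 1 [bracket x y]" for x y
  proof -
    have "fps_linear_ext P (fps_bilinear_ext M' (fps_const x) (fps_const y)) =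
        fps_bilinear_ext M (fps_linear_ext P (fps_const x)) (fps_linear_ext P (fps_const y))"
      using morphism by (simp add: rota_baxter_morphism_def)
    from arg_cong[OF this, of "\<lambda>s. fps_nth s (Suc 0)"] show ?thesis
      using bracket_swap[of y "fps_nth P 1 [x]"] by (simp add: coefficients algebra_simps)
  qed
  have operator_1: "fps_nth N' 1 [x] - fps_nth N 1 [x] = T (fps_nth P 1 [x]) - fps_nth P 1 [T x]" for x
  proof -
    have "fps_linear_ext P (fps_linear_ext N' (fps_const x)) =
        fps_linear_ext N (fps_linear_ext P (fps_const x))"
      using morphism by (simp add: rota_baxter_morphism_def fun_eq_iff)
    from arg_cong[OF this, of "\<lambda>s. fps_nth s (Suc 0)"] show ?thesis
      by (simp add: coefficients algebra_simps)
  qed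
  have "fps_nth M' 1 - fps_nth M 1 = ce_differential scale bracket bracket 1 (fps_nth P 1)"
  proof
    show "(fps_nth M' 1 - fps_nth M 1) xs = ce_differential scale bracket bracket 1 (fps_nth P 1) xs" for xs
    proof (cases "length xs = 2")
      case True
      then obtain x y where "xs = [x, y]" by (auto simp: length_2_iff)
      then show ?thesis using bracket_1[of x y] ce_differential_1[of bracket bracket "fps_nth P 1" x y]
        by simp
    qed (simp add: ce_differential_def length_M[unfolded One_nat_def])
  qed
  moreover have "fps_nth N' 1 - fps_nth N 1 =
      - ce_differential scale (induced_bracket scale bracket lam T) (induced_action bracket T) 0 0
      - rb_Phi scale lam T 1 (fps_nth P 1)"
  proof
    show "(fps_nth N' 1 - fps_nth N 1) xs =
      (- ce_differential scale (induced_bracket scale bracket lam T) (induced_action bracket T) 0 0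
      - rb_Phi scale lam T 1 (fps_nth P 1)) xs" for xs
    proof (cases "length xs = 1")
      case True
      then obtain x where "xs = [x]" by (auto simp: length_Suc_conv)
      then show ?thesis using operator_1[of x] rb_Phi_1[of "fps_nth P 1" x]
        by (simp add: ce_differential_def induced_action_def bracket_simps T_simps)
    qed (simp add: ce_differential_def rb_Phi_def length_N[unfolded One_nat_def])
  qed
  ultimately have "(fps_nth M' 1, fps_nth N' 1) - (fps_nth M 1, fps_nth N 1) =
      rb_differential scale bracket lam T 1 (fps_nth P 1, 0)"
    by (simp add: rb_differential_def)
  moreover have "(fps_nth P 1, 0) \<in> rb_cochains scale 1"
    using P alt_hom_zero module_axioms by (simp add: rb_cochains_def)
  ultimately show ?thesis by (auto simp: rb_coboundaries_def simp del: diff_Pair)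
qed

end

theorem theorem4p6:
  fixes scale :: "'k::field_char_0 \<Rightarrow> 'v::ab_group_add \<Rightarrow> 'v"
    and bracket :: "'v \<Rightarrow> 'v \<Rightarrow> 'v"
    and lam :: 'k
    and T :: "'v \<Rightarrow> 'v"
    and M N :: "('v list \<Rightarrow> 'v) fps"
  assumes "rota_baxter_lie_algebra scale bracket lam T"
    and "rb_deformation scale bracket lam T M N"
  shows "(fps_nth M 1, fps_nth N 1) \<in> rb_cocycles scale bracket lam T 2 \<and>
    rb_class scale bracket lam T 2 (fps_nth M 1, fps_nth N 1) \<in> rb_cohomology scale bracket lam T 2 \<and>
    (\<forall>M' N'. rb_deformation scale bracket lam T M' N' \<longrightarrow> rb_equivalent scale lam M N M' N' \<longrightarrow>
      rb_class scale bracket lam T 2 (fps_nth M' 1, fps_nth N' 1) =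
      rb_class scale bracket lam T 2 (fps_nth M 1, fps_nth N 1))"
proof -
  interpret rota_baxter_lie_algebra scale bracket lam T by (rule assms(1))
  note cocycle = rb_deformation_infinitesimal_cocycle
  have "rb_class scale bracket lam T 2 (fps_nth M 1, fps_nth N 1) \<in> rb_cohomology scale bracket lam T 2"
    unfolding rb_class_def rb_cohomology_def by (rule quotientI[OF cocycle[OF assms(2)]])
  then show ?thesis
    using cocycle assms(2) rb_equivalent_infinitesimals_cohomologous rb_class_eqI by blast
qed

end
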